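(* Let $U$ be a nonempty finite set and let $\mathcal{F} \subseteq 2^U$ be an ideal family on $U$. Then $\mathcal{F}$ has a rare vertex, i.e. there exists $v \in U$ with $\deg_{\mathcal{F}}(v) \leq |\mathcal{F}|/2$.
   Context: Let $U$ be a nonempty finite set (the ground set); its elements are called vertices. A set family $\mathcal{F}$ on $U$ is a collection of subsets of $U$; its members are called hyperedges. A set family $\mathcal{F} \subseteq 2^U$ is an ideal family on $U$ if: (1) $\emptyset \in \mathcal{F}$; (2) $U \in \mathcal{F}$; (3) (downward-closed except $U$) for every $A \in \mathcal{F}$ with $A \neq U$ and every $B \subseteq A$, one has $B \in \mathcal{F}$. For $v \in U$, the degree of $v$ in $\mathcal{F}$ is $\deg_{\mathcal{F}}(v) = |\{H \in \mathcal{F} \mid v \in H\}|$. A vertex $v \in U$ is rare in $\mathcal{F}$ if $\deg_{\mathcal{F}}(v) \leq |\mathcal{F}|/2$. *)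

theory Defs
  imports Complex_Main
begin

definition ideal_family :: "'a set \<Rightarrow> 'a set set \<Rightarrow> bool" where
  "ideal_family U F \<longleftrightarrow>
     F \<subseteq> Pow U \<and> {} \<in> F \<and> U \<in> F \<and>
     (\<forall>A\<in>F. A \<noteq> U \<longrightarrow> (\<forall>B. B \<subseteq> A \<longrightarrow> B \<in> F))"

definition degree :: "'a set set \<Rightarrow> 'a \<Rightarrow> nat" where
  "degree F v = card {H \<in> F. v \<in> H}"

(* The half is taken in the reals, not by truncating division on nat. *)
definition rare :: "'a set \<Rightarrow> 'a set set \<Rightarrow> 'a \<Rightarrow> bool" where
  "rare U F v \<longleftrightarrow> v \<in> U \<and> real (degree F v) \<le> real (card F) / 2"

end

(* Let A be maximal among the members other than U, and let v be a vertex outside A.  Sending each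
   member H containing v to H - {v} if H differs from U, and U to A, injects the members containing v
   into those avoiding v: H - {v} = A with H different from U would make H a member strictly
   between A and U. *)
theory Submission
  imports Defs
begin

theorem lemma2p2:
  fixes U :: "'a set" and F :: "'a set set"
  assumes "finite U" and "U \<noteq> {}" and "ideal_family U F"
  shows "\<exists>v\<in>U. rare U F v"
proof -
  have sub: "F \<subseteq> Pow U" and emp: "{} \<in> F"
    and down: "\<And>A B. A \<in> F \<Longrightarrow> A \<noteq> U \<Longrightarrow> B \<subseteq> A \<Longrightarrow> B \<in> F"
    using assms(3) by (auto simp: ideal_family_def)
  have fin: "finite F"
    using sub assms(1) by (simp add: finite_subset)
  \<comment> \<open>Since \<open>U\<close> is nonempty, \<open>{}\<close> lies in
    \<open>F - {U}\<close>, so this finite set has a maximal element.\<close>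
  have "\<exists>A\<in>F - {U}. \<forall>B\<in>F - {U}. A \<subseteq> B \<longrightarrow> A = B"
    by (rule finite_has_maximal) (use fin emp assms(2) in auto)
  then obtain A where A: "A \<in> F" "A \<noteq> U"
    and max: "\<And>B. B \<in> F \<Longrightarrow> B \<noteq> U \<Longrightarrow> A \<subseteq> B \<Longrightarrow> A = B"
    by blast
  obtain v where v: "v \<in> U" "v \<notin> A"
    using A sub by blast
  define P where "P = {H \<in> F. v \<in> H}"
  define Q where "Q = {H \<in> F. v \<notin> H}"
  define f where "f H = (if H = U then A else H - {v})" for H
  have ne: "H - {v} \<noteq> A" if "H \<in> P" "H \<noteq> U" for H
    using max[of H] that v by (auto simp: P_def)
  have "inj_on f P"
  proof (rule inj_onI)
    fix H K assume HK: "H \<in> P" "K \<in> P" "f H = f K"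
    show "H = K"
    proof (cases "H = U \<or> K = U")
      \<comment> \<open>If only one of \<open>H\<close>, \<open>K\<close> is \<open>U\<close>, then
        \<open>f H = f K\<close> equates \<open>A\<close> with the other set minus \<open>v\<close>,
        which \<open>ne\<close> excludes.\<close>
      case True
      then show ?thesis
        using HK ne[of H] ne[of K] by (auto simp: f_def split: if_splits)
    next
      case False
      \<comment> \<open>Both sets contain \<open>v\<close>, so putting it back recovers
        them.\<close>
      then have "insert v (H - {v}) = insert v (K - {v})"
        using HK(3) by (simp add: f_def)
      then show ?thesis
        using HK by (simp add: P_def insert_absorb)
    qed
  qed
  \<comment> \<open>For \<open>H\<close> other than \<open>U\<close>, downward closure keeps
    \<open>H - {v}\<close> in \<open>F\<close>; \<open>U\<close> goes to \<open>A\<close>, which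
    avoids \<open>v\<close> by choice.\<close>
  moreover have "f ` P \<subseteq> Q"
    using A v down[OF _ _ Diff_subset] by (auto simp: f_def P_def Q_def)
  ultimately have "card P \<le> card Q"
    using fin by (intro card_inj_on_le) (auto simp: Q_def)
  moreover have "card F = card P + card Q"
  proof -
    have "F = P \<union> Q" "P \<inter> Q = {}"
      by (auto simp: P_def Q_def)
    then show ?thesis
      using fin by (metis card_Un_disjoint finite_Un)
  qed
  \<comment> \<open>The degree of \<open>v\<close> is \<open>card P\<close>, and twice
    \<open>card P\<close> is at most \<open>card P + card Q\<close>.\<close>
  ultimately have "rare U F v"
    using v by (simp add: rare_def degree_def P_def)
  then show ?thesis
    using v by blast
qed

end
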